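(* Every $C^2$ regular time-like curve in $\mathbb{L}^4$ admits a frame of type B.
   Context: $\mathbb{L}^4$ is $\mathbb{R}^4$ with the Lorentzian inner product $\langle\cdot,\cdot\rangle$ of signature $(-,+,+,+)$. A regular time-like curve is a curve $\gamma:I\to\mathbb{L}^4$ on an open interval $I$ with $\langle\gamma',\gamma'\rangle<0$ everywhere. It is parametrized by proper time $s$, so that $\mathbb{T}=\gamma'$ satisfies $\langle\mathbb{T},\mathbb{T}\rangle=-1$, and $'$ denotes $d/ds$. A frame of type B (Bishop frame) of $\gamma$ is a family of vector fields $\{\mathbb{T},\mathbb{B}_1,\mathbb{B}_2,\mathbb{B}_3\}$ along $\gamma$, of class $C^1$ for a $C^2$ curve, with $\langle\mathbb{T},\mathbb{B}_i\rangle=0$ and $\langle\mathbb{B}_i,\mathbb{B}_j\rangle=\delta_{ij}$, such that for some functions $b_1,b_2,b_3$ on $I$ $$\begin{pmatrix}\mathbb{T}'\\ \mathbb{B}_1'\\ \mathbb{B}_2'\\ \mathbb{B}_3'\end{pmatrix}=\begin{pmatrix}0&b_1&b_2&b_3\\ b_1&0&0&0\\ b_2&0&0&0\\ b_3&0&0&0\end{pmatrix}\begin{pmatrix}\mathbb{T}\\ \mathbb{B}_1\\ \mathbb{B}_2\\ \mathbb{B}_3\end{pmatrix}.$$ *)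

theory Defs
  imports "HOL-Analysis.Analysis"
begin

text \<open>Minkowski space is the type \<^typ>\<open>real^4\<close>, the first coordinate being the
  time-like one.\<close>

definition lorentz :: "real^4 \<Rightarrow> real^4 \<Rightarrow> real"
  where "lorentz x y = - (x $ 1 * y $ 1) + x $ 2 * y $ 2 + x $ 3 * y $ 3 + x $ 4 * y $ 4"

text \<open>Empty and unbounded intervals are included.\<close>

definition open_interval :: "real set \<Rightarrow> bool"
  where "open_interval I \<longleftrightarrow> open I \<and> is_interval I"

definition C2_on :: "(real \<Rightarrow> 'a::real_normed_vector) \<Rightarrow> real set \<Rightarrow> bool"
  where "C2_on f I \<longleftrightarrow>
    (\<exists>f'. (\<forall>t\<in>I. (f has_vector_derivative f' t) (at t)) \<and> f' C1_differentiable_on I)"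

definition regular_timelike_curve :: "(real \<Rightarrow> real^4) \<Rightarrow> real set \<Rightarrow> bool"
  where "regular_timelike_curve \<gamma> I \<longleftrightarrow>
    open_interval I \<and>
    (\<forall>t\<in>I. \<gamma> differentiable at t \<and>
      lorentz (vector_derivative \<gamma> (at t)) (vector_derivative \<gamma> (at t)) < 0)"

text \<open>The rate \<open>ds/dt\<close> of the proper time \<open>s\<close> with respect to an arbitrary parameter \<open>t\<close>.\<close>

definition proper_speed :: "(real \<Rightarrow> real^4) \<Rightarrow> real \<Rightarrow> real"
  where "proper_speed \<gamma> t =
    sqrt (- lorentz (vector_derivative \<gamma> (at t)) (vector_derivative \<gamma> (at t)))"

text \<open>Differentiation \<open>d/ds\<close> along a curve that need not be parametrized by proper time:
  \<open>dX/ds = D\<close> means \<open>dX/dt = (ds/dt) D\<close>. The two lemmas below show that this is the ordinary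
  derivative if the parameter is proper time, and that it is the derivative with respect to
  \<open>s\<close> if the field is a function of \<open>s\<close>.\<close>

definition has_proper_time_derivative ::
    "(real \<Rightarrow> real^4) \<Rightarrow> (real \<Rightarrow> real^4) \<Rightarrow> real^4 \<Rightarrow> real \<Rightarrow> bool"
  where "has_proper_time_derivative \<gamma> X D t \<longleftrightarrow>
    (X has_vector_derivative (proper_speed \<gamma> t *\<^sub>R D)) (at t)"

lemma has_proper_time_derivative_unit_speed:
  assumes "lorentz (vector_derivative \<gamma> (at t)) (vector_derivative \<gamma> (at t)) = -1"
  shows "has_proper_time_derivative \<gamma> X D t \<longleftrightarrow> (X has_vector_derivative D) (at t)"
  using assms by (simp add: has_proper_time_derivative_def proper_speed_def)

lemma has_proper_time_derivative_reparam:
  assumes "(s has_vector_derivative proper_speed \<gamma> t) (at t)"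
    and "(Y has_vector_derivative D) (at (s t))"
  shows "has_proper_time_derivative \<gamma> (Y \<circ> s) D t"
  unfolding has_proper_time_derivative_def
  by (rule vector_diff_chain_at[OF assms])

text \<open>A frame of type B (Bishop frame): \<open>T\<close> is the unit tangent, \<open>b i\<close> are the coefficients
  \<open>b\<^sub>i\<close>, and the last two clauses are the rows of the matrix equation.\<close>

definition type_B_frame ::
    "(real \<Rightarrow> real^4) \<Rightarrow> real set \<Rightarrow> (real \<Rightarrow> real^4) \<Rightarrow> (3 \<Rightarrow> real \<Rightarrow> real^4) \<Rightarrow> bool"
  where "type_B_frame \<gamma> I T B \<longleftrightarrow>
    (\<forall>t\<in>I. has_proper_time_derivative \<gamma> \<gamma> (T t) t) \<and>
    T C1_differentiable_on I \<and>
    (\<forall>i. B i C1_differentiable_on I) \<and>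
    (\<forall>t\<in>I. \<forall>i. lorentz (T t) (B i t) = 0) \<and>
    (\<forall>t\<in>I. \<forall>i j. lorentz (B i t) (B j t) = (if i = j then 1 else 0)) \<and>
    (\<exists>b :: 3 \<Rightarrow> real \<Rightarrow> real. \<forall>t\<in>I.
      has_proper_time_derivative \<gamma> T (\<Sum>i\<in>UNIV. b i t *\<^sub>R B i t) t \<and>
      (\<forall>i. has_proper_time_derivative \<gamma> (B i) (b i t *\<^sub>R T t) t))"

end

theory Submission
  imports Defs
begin

text \<open>Let \<open>T\<close> be the unit tangent and \<open>T'\<close> its derivative in the given parameter, which is
  continuous since the curve is of class \<open>C\<^sup>2\<close>. A field \<open>X\<close> normal to the curve whose derivative
  is a multiple \<open>\<lambda> T\<close> must satisfy \<open>0 = \<langle>T, X\<rangle>' = \<langle>T', X\<rangle> - \<lambda>\<close>, hence \<open>X' = \<langle>T', X\<rangle> T\<close>.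
  This is a linear differential equation with continuous coefficients, so it has a solution on the
  whole interval for every initial value (\<open>linear_ode_solution_exists\<close>, by Picard iteration).
  Conversely, a solution that starts normal to the curve stays normal, since \<open>\<langle>T, X\<rangle>' = 0\<close> along
  every solution (\<open>bishop_field_orthogonal\<close>); and the Lorentzian product of two normal solutions
  is constant, since their derivatives are multiples of \<open>T\<close> (\<open>bishop_fields_lorentz_constant\<close>).

  It therefore suffices to choose an orthonormal basis of the complement of \<open>T\<close> at one parameter
  value (\<open>lorentz_orthonormal_complement_exists\<close>) and to solve the equation for each of the three
  initial vectors. The equation itself gives the rows for the fields \<open>B\<^sub>i\<close>, with coefficients
  \<open>\<langle>T', B\<^sub>i\<rangle>\<close>. The row for \<open>T\<close> is the expansion of \<open>T'\<close>, which is orthogonal to \<open>T\<close>, in the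
  basis \<open>B\<^sub>1, B\<^sub>2, B\<^sub>3\<close> of that complement (\<open>lorentz_orthonormal_complement_expansion\<close>). Division
  by \<open>ds/dt\<close> turns all these coefficients into the ones with respect to proper time.\<close>

section \<open>Linear differential equations on an open interval\<close>

lemma open_interval_compact_neighbourhood:
  fixes s t :: real
  assumes "open I" "is_interval I" "s \<in> I" "t \<in> I"
  obtains a b where "a < s" "s < b" "a < t" "t < b" "{a..b} \<subseteq> I"
proof -
  have "min s t \<in> I" "max s t \<in> I"
    using assms(3,4) by (simp_all add: min_def max_def)
  then obtain d e where "d > 0" "cball (min s t) d \<subseteq> I" "e > 0" "cball (max s t) e \<subseteq> I"
    using \<open>open I\<close> by (metis open_contains_cball)
  then have "min s t - d \<in> I" "max s t + e \<in> I"
    by (auto simp: subset_iff dist_real_def)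
  then have "{min s t - d..max s t + e} \<subseteq> I"
    using \<open>is_interval I\<close> unfolding is_interval_1 by (meson atLeastAtMost_iff subsetI)
  with \<open>d > 0\<close> \<open>e > 0\<close> show thesis
    by (intro that[of "min s t - d" "max s t + e"]) auto
qed

lemma has_vector_derivative_integral_open_interval:
  fixes f :: "real \<Rightarrow> 'a::euclidean_space"
  assumes "open I" "is_interval I" "t0 \<in> I" "t \<in> I" "continuous_on I f"
  shows "((\<lambda>t. LBINT s=t0..t. f s) has_vector_derivative f t) (at t)"
proof -
  obtain a b where ab: "a < t0" "t0 < b" "a < t" "t < b" "{a..b} \<subseteq> I"
    using open_interval_compact_neighbourhood assms(1-4) by blast
  have "((\<lambda>t. LBINT s=t0..t. f s) has_vector_derivative f t) (at t within {a..b})"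
    using ab by (intro interval_integral_FTC2 continuous_on_subset[OF assms(5)]) auto
  moreover have "at t within {a..b} = at t"
    using ab(3,4) by (rule at_within_Icc_at)
  ultimately show ?thesis by simp
qed

text \<open>Integrates a bound on the derivative to both sides of \<open>t0\<close> at once: restricting \<open>u\<close> to the
  oriented segment from \<open>t0\<close> to \<open>t\<close>, with parameter in \<open>[0,1]\<close>, avoids the case distinction on
  the sign of \<open>t - t0\<close>.\<close>

lemma norm_bound_from_power_derivative_bound:
  fixes u :: "real \<Rightarrow> 'a::real_normed_vector"
  assumes u: "\<And>s. s \<in> {a..b} \<Longrightarrow> (u has_vector_derivative v s) (at s)"
    and v: "\<And>s. s \<in> {a..b} \<Longrightarrow> norm (v s) \<le> C * \<bar>s - t0\<bar> ^ n"
    and t0: "t0 \<in> {a..b}" "u t0 = 0" and t: "t \<in> {a..b}"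
  shows "norm (u t) \<le> C * \<bar>t - t0\<bar> ^ Suc n / Suc n"
proof -
  define p where "p = (\<lambda>r. t0 + r * (t - t0))"
  have p: "p r \<in> {a..b}" if "0 \<le> r" "r \<le> 1" for r
  proof -
    have "convex {a..b}" by simp
    then have "(1 - r) *\<^sub>R t0 + r *\<^sub>R t \<in> {a..b}"
      using t0 t that by (intro convexD) auto
    then show ?thesis by (simp add: p_def algebra_simps)
  qed
  have p': "(p has_vector_derivative (t - t0)) (at r)" for r
    unfolding p_def has_real_derivative_iff_has_vector_derivative[symmetric]
    by (auto intro!: derivative_eq_intros)
  have up: "((\<lambda>r. u (p r)) has_vector_derivative (t - t0) *\<^sub>R v (p r)) (at r)"
    if "0 \<le> r" "r \<le> 1" for r
    using vector_diff_chain_at[OF p' u[OF p[OF that]]] by (simp add: o_def)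
  let ?\<phi> = "\<lambda>r. C * \<bar>t - t0\<bar> ^ Suc n / Suc n * r ^ Suc n"
  have \<phi>: "(?\<phi> has_vector_derivative C * \<bar>t - t0\<bar> ^ Suc n * r ^ n) (at r)" for r
    unfolding has_real_derivative_iff_has_vector_derivative[symmetric]
    by (rule derivative_eq_intros refl)+ (simp add: field_simps del: of_nat_Suc)
  have "norm (u (p 1) - u (p 0)) \<le> ?\<phi> 1 - ?\<phi> 0"
  proof (rule differentiable_bound_general[OF _ _ _ up \<phi>])
    show "continuous_on {0..1} (\<lambda>r. u (p r))"
      by (rule continuous_on_vector_derivative) (use up in \<open>auto intro: has_vector_derivative_at_within\<close>)
    show "continuous_on {0..1} ?\<phi>"
      by (intro continuous_intros) auto
    fix r :: real assume r: "0 < r" "r < 1"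
    have "norm ((t - t0) *\<^sub>R v (p r)) \<le> \<bar>t - t0\<bar> * (C * \<bar>p r - t0\<bar> ^ n)"
      using v[OF p, of r] r by (auto intro: mult_left_mono)
    also have "\<dots> = C * \<bar>t - t0\<bar> ^ Suc n * r ^ n"
      using r by (simp add: p_def abs_mult power_mult_distrib)
    finally show "norm ((t - t0) *\<^sub>R v (p r)) \<le> C * \<bar>t - t0\<bar> ^ Suc n * r ^ n" .
  qed auto
  then show ?thesis using t0 by (simp add: p_def)
qed

text \<open>The difference of the \<open>n\<close>-th and the preceding Picard iterate for \<open>x' = A x\<close>,
  \<open>x t0 = x0\<close>. The solution is the sum of these terms.\<close>

primrec picard_term ::
    "(real \<Rightarrow> 'a::euclidean_space \<Rightarrow>\<^sub>L 'a) \<Rightarrow> real \<Rightarrow> 'a \<Rightarrow> nat \<Rightarrow> real \<Rightarrow> 'a"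
  where
    "picard_term A t0 x0 0 = (\<lambda>t. x0)"
  | "picard_term A t0 x0 (Suc n) = (\<lambda>t. LBINT s=t0..t. A s (picard_term A t0 x0 n s))"

primrec picard_term_deriv ::
    "(real \<Rightarrow> 'a::euclidean_space \<Rightarrow>\<^sub>L 'a) \<Rightarrow> real \<Rightarrow> 'a \<Rightarrow> nat \<Rightarrow> real \<Rightarrow> 'a"
  where
    "picard_term_deriv A t0 x0 0 = (\<lambda>t. 0)"
  | "picard_term_deriv A t0 x0 (Suc n) = (\<lambda>t. A t (picard_term A t0 x0 n t))"

lemma picard_term_at_start: "picard_term A t0 x0 n t0 = (if n = 0 then x0 else 0)"
  by (cases n) auto

lemma picard_term_has_vector_derivative:
  assumes "open I" "is_interval I" "t0 \<in> I" "continuous_on I A" "t \<in> I"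
  shows "(picard_term A t0 x0 n has_vector_derivative picard_term_deriv A t0 x0 n t) (at t)"
  using assms(5)
proof (induction n arbitrary: t)
  case (Suc n)
  have "continuous_on I (picard_term A t0 x0 n)"
    by (rule continuous_on_vector_derivative) (use Suc.IH in \<open>auto intro: has_vector_derivative_at_within\<close>)
  then have "continuous_on I (\<lambda>s. A s (picard_term A t0 x0 n s))"
    using assms(4) by (intro continuous_intros)
  from has_vector_derivative_integral_open_interval[OF assms(1-3) Suc.prems this]
  show ?case by simp
qed simp

text \<open>The factorial comes from integrating \<open>\<bar>s - t0\<bar>\<close> to successive powers. It makes the series
  converge on every compact part of the interval, however large the bound on \<open>A\<close> is there, so no
  gluing of local solutions is necessary.\<close>

lemma picard_term_bound:
  assumes I: "open I" "is_interval I" "continuous_on I A"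
    and ab: "{a..b} \<subseteq> I" "t0 \<in> {a..b}" "t \<in> {a..b}"
    and K: "\<And>s. s \<in> {a..b} \<Longrightarrow> norm (A s) \<le> K"
  shows "norm (picard_term A t0 x0 n t) \<le> norm x0 * (K * \<bar>t - t0\<bar>) ^ n / fact n"
  using ab(3)
proof (induction n arbitrary: t)
  case (Suc n)
  let ?C = "norm x0 * K ^ Suc n / fact n"
  have "K \<ge> 0" using K[OF ab(2)] norm_ge_zero order_trans by blast
  have "norm (picard_term A t0 x0 (Suc n) t) \<le> ?C * \<bar>t - t0\<bar> ^ Suc n / Suc n"
  proof (rule norm_bound_from_power_derivative_bound[OF _ _ ab(2) _ Suc.prems])
    fix s assume s: "s \<in> {a..b}"
    show "(picard_term A t0 x0 (Suc n) has_vector_derivative picard_term_deriv A t0 x0 (Suc n) s) (at s)"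
      using s ab by (intro picard_term_has_vector_derivative[OF I(1,2) _ I(3)]) auto
    have "norm (A s (picard_term A t0 x0 n s)) \<le> norm (A s) * norm (picard_term A t0 x0 n s)"
      by (rule norm_blinfun)
    also have "\<dots> \<le> K * (norm x0 * (K * \<bar>s - t0\<bar>) ^ n / fact n)"
      using s \<open>K \<ge> 0\<close> by (intro mult_mono K Suc.IH) auto
    finally show "norm (picard_term_deriv A t0 x0 (Suc n) s) \<le> ?C * \<bar>s - t0\<bar> ^ n"
      by (simp add: power_mult_distrib mult_ac)
  qed simp
  then show ?case by (simp add: power_mult_distrib mult_ac)
qed simp

text \<open>The Picard series solves the equation by differentiation term by term: the derivative of each
  term is \<open>A\<close> applied to the preceding one, so the series of derivatives is a shift of \<open>A\<close> applied
  to the series itself, and both converge uniformly on compact intervals by comparison with an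
  exponential series.\<close>

lemma linear_ode_solution_exists:
  fixes A :: "real \<Rightarrow> 'a::euclidean_space \<Rightarrow>\<^sub>L 'a"
  assumes I: "open I" "is_interval I" and t0: "t0 \<in> I" and A: "continuous_on I A"
  obtains x where "x t0 = x0" "\<And>t. t \<in> I \<Longrightarrow> (x has_vector_derivative A t (x t)) (at t)"
proof (rule that[of "\<lambda>t. \<Sum>n. picard_term A t0 x0 n t"])
  let ?u = "picard_term A t0 x0" and ?u' = "picard_term_deriv A t0 x0"
  let ?x = "\<lambda>t. \<Sum>n. ?u n t"
  have "(\<lambda>n. ?u n t0) sums x0"
    unfolding picard_term_at_start by (rule sums_single)
  then show "?x t0 = x0" by (simp add: sums_iff)
  fix t assume t: "t \<in> I"
  obtain a b where ab: "a < t0" "t0 < b" "a < t" "t < b" "{a..b} \<subseteq> I"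
    using open_interval_compact_neighbourhood I t0 t by blast
  have "bounded (A ` {a..b})"
    by (intro compact_imp_bounded compact_continuous_image continuous_on_subset[OF A ab(5)] compact_Icc)
  then obtain K where "K > 0" and K: "\<And>s. s \<in> {a..b} \<Longrightarrow> norm (A s) \<le> K"
    by (auto simp: bounded_pos)
  define R where "R = K * (b - a)"
  have u_bound: "norm (?u n s) \<le> norm x0 * R ^ n / fact n" if s: "s \<in> {a..b}" for n s
  proof -
    have "norm (?u n s) \<le> norm x0 * (K * \<bar>s - t0\<bar>) ^ n / fact n"
      using s ab by (intro picard_term_bound[OF I A ab(5) _ _ K]) auto
    also have "\<dots> \<le> norm x0 * R ^ n / fact n"
      using s ab \<open>K > 0\<close> unfolding R_def
      by (intro divide_right_mono mult_left_mono power_mono) auto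
    finally show ?thesis .
  qed
  have sum_bound: "summable (\<lambda>n. norm x0 * R ^ n / fact n)"
    using summable_mult[OF summable_exp_generic[of R], of "norm x0"]
    by (simp add: divide_inverse mult_ac)
  have u_summable: "summable (\<lambda>n. ?u n s)" if "s \<in> {a..b}" for s
    by (rule summable_comparison_test'[OF sum_bound, of 0]) (use u_bound that in auto)
  have u'_bound: "norm (?u' n s) \<le> (if n = 0 then 0 else K * (norm x0 * R ^ (n-1) / fact (n-1)))"
    if s: "s \<in> {a..b}" for n s
  proof (cases n)
    case (Suc m)
    have "norm (A s (?u m s)) \<le> norm (A s) * norm (?u m s)"
      by (rule norm_blinfun)
    also have "\<dots> \<le> K * (norm x0 * R ^ m / fact m)"
      using s \<open>K > 0\<close> by (intro mult_mono K u_bound) auto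
    finally show ?thesis using Suc by simp
  qed simp
  have sum_bound': "summable (\<lambda>n. if n = 0 then 0 else K * (norm x0 * R ^ (n-1) / fact (n-1)))"
    by (subst summable_Suc_iff[symmetric]) (use summable_mult[OF sum_bound] in simp)
  have u'_limit: "uniform_limit {a..b} (\<lambda>n s. \<Sum>i<n. ?u' i s) (\<lambda>s. \<Sum>i. ?u' i s) sequentially"
    using u'_bound sum_bound' by (rule Weierstrass_m_test)
  have u'_sums: "(\<Sum>i. ?u' i s) = A s (?x s)" if "s \<in> {a..b}" for s
  proof -
    have "summable (\<lambda>n. A s (?u n s))" "A s (?x s) = (\<Sum>n. A s (?u n s))"
      using u_summable[OF that]
      by (auto intro: blinfun.bounded_linear_right bounded_linear.summable bounded_linear.suminf)
    moreover have "summable (\<lambda>n. ?u' n s)"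
      by (subst summable_Suc_iff[symmetric]) (simp add: calculation(1))
    ultimately show ?thesis
      using suminf_split_head[of "\<lambda>n. ?u' n s"] by simp
  qed
  have "\<exists>g. \<forall>s\<in>{a..b}. (\<lambda>n. ?u n s) sums g s \<and>
      (g has_derivative (\<lambda>h. h *\<^sub>R A s (?x s))) (at s within {a..b})"
  proof (rule has_derivative_series)
    show "(?u n has_derivative (\<lambda>h. h *\<^sub>R ?u' n s)) (at s within {a..b})" if "s \<in> {a..b}" for n s
      using has_vector_derivative_at_within[OF picard_term_has_vector_derivative[OF I t0 A]] that ab
      unfolding has_vector_derivative_def by blast
    fix e :: real assume "e > 0"
    with u'_limit have "\<forall>\<^sub>F n in sequentially. \<forall>s\<in>{a..b}. dist (\<Sum>i<n. ?u' i s) (\<Sum>i. ?u' i s) < e"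
      by (simp add: uniform_limit_iff)
    then show "\<forall>\<^sub>F n in sequentially. \<forall>s\<in>{a..b}. \<forall>h.
        norm ((\<Sum>i<n. h *\<^sub>R ?u' i s) - h *\<^sub>R A s (?x s)) \<le> e * norm h"
    proof (eventually_elim, intro ballI allI)
      fix n s h
      assume "\<forall>s\<in>{a..b}. dist (\<Sum>i<n. ?u' i s) (\<Sum>i. ?u' i s) < e" and s: "s \<in> {a..b}"
      then have "norm ((\<Sum>i<n. ?u' i s) - A s (?x s)) \<le> e"
        using u'_sums[OF s] by (force simp: dist_norm)
      then have "\<bar>h\<bar> * norm ((\<Sum>i<n. ?u' i s) - A s (?x s)) \<le> \<bar>h\<bar> * e"
        by (intro mult_left_mono) auto
      then show "norm ((\<Sum>i<n. h *\<^sub>R ?u' i s) - h *\<^sub>R A s (?x s)) \<le> e * norm h"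
        by (simp add: scaleR_sum_right[symmetric] scaleR_diff_right[symmetric] mult.commute)
    qed
  next
    show "t \<in> {a..b}" using ab by simp
    then show "(\<lambda>n. ?u n t) sums ?x t" by (intro summable_sums u_summable)
  qed simp
  then obtain g where g: "\<And>s. s \<in> {a..b} \<Longrightarrow> g s = ?x s"
      "\<And>s. s \<in> {a..b} \<Longrightarrow> (g has_derivative (\<lambda>h. h *\<^sub>R A s (?x s))) (at s within {a..b})"
    by (metis sums_iff)
  have "(?x has_derivative (\<lambda>h. h *\<^sub>R A t (?x t))) (at t within {a..b})"
    by (rule has_derivative_transform[OF _ _ g(2)]) (use ab g(1) in auto)
  moreover have "at t within {a..b} = at t"
    using ab(3,4) by (rule at_within_Icc_at)
  ultimately show "(?x has_vector_derivative A t (?x t)) (at t)"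
    by (simp add: has_vector_derivative_def)
qed

section \<open>Lorentz-orthonormal bases\<close>

lemma bounded_bilinear_lorentz: "bounded_bilinear lorentz"
  unfolding bilinear_conv_bounded_bilinear[symmetric] bilinear_def
  by (auto intro!: linearI simp: lorentz_def algebra_simps)

interpretation lorentz: bounded_bilinear lorentz
  by (rule bounded_bilinear_lorentz)

lemma lorentz_commute: "lorentz x y = lorentz y x"
  by (simp add: lorentz_def mult.commute)

text \<open>If \<open>M\<close> has the vectors \<open>e i\<close> as columns and \<open>\<eta>\<close> is the diagonal matrix of the signature,
  orthonormality reads \<open>(\<eta> M\<^sup>T \<eta>) M = 1\<close>. A left inverse of a square matrix is also a right
  inverse, and \<open>M (\<eta> M\<^sup>T \<eta>) = 1\<close> is the expansion.\<close>

lemma lorentz_orthonormal_expansion: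
  fixes e :: "4 \<Rightarrow> real^4" and w :: "real^4"
  defines "\<epsilon> \<equiv> \<lambda>i::4. if i = 1 then -1 else 1 :: real"
  assumes e: "\<And>i j. lorentz (e i) (e j) = (if i = j then \<epsilon> i else 0)"
  shows "w = (\<Sum>i\<in>UNIV. (\<epsilon> i * lorentz (e i) w) *\<^sub>R e i)"
proof -
  define M :: "real^4^4" where "M = (\<chi> k i. e i $ k)"
  define N :: "real^4^4" where "N = (\<chi> i k. \<epsilon> i * e i $ k * \<epsilon> k)"
  have \<epsilon>: "\<epsilon> 1 = -1" "\<epsilon> 2 = 1" "\<epsilon> 3 = 1" "\<epsilon> 4 = 1" by (simp_all add: \<epsilon>_def)
  have N: "(N *v x) $ i = \<epsilon> i * lorentz (e i) x" for x i
    by (simp add: N_def matrix_vector_mult_def sum_4 lorentz_def \<epsilon> algebra_simps)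
  have "(N ** M) $ i $ j = \<epsilon> i * lorentz (e i) (e j)" for i j
    by (simp add: N_def M_def matrix_matrix_mult_def sum_4 lorentz_def \<epsilon> algebra_simps)
  then have "N ** M = mat 1"
    by (simp add: vec_eq_iff mat_def e) (simp add: \<epsilon>_def)
  then have "M ** N = mat 1" by (simp add: matrix_left_right_inverse)
  then have "w = M *v (N *v w)" by (simp add: matrix_vector_mul_assoc)
  also have "\<dots> = (\<Sum>i\<in>UNIV. (\<epsilon> i * lorentz (e i) w) *\<^sub>R e i)"
    by (simp add: vec_eq_iff M_def matrix_vector_mult_def[of "\<chi> k i. e i $ k"] N mult.commute)
  finally show ?thesis .
qed

lemma lorentz_orthonormal_complement_expansion:
  fixes B :: "3 \<Rightarrow> real^4"
  assumes T: "lorentz T T = -1" and TB: "\<And>i. lorentz T (B i) = 0"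
    and B: "\<And>i j. lorentz (B i) (B j) = (if i = j then 1 else 0)"
    and w: "lorentz T w = 0"
  shows "w = (\<Sum>i\<in>UNIV. lorentz w (B i) *\<^sub>R B i)"
proof -
  define e :: "4 \<Rightarrow> real^4" where
    "e = (\<lambda>i. if i = 1 then T else if i = 2 then B 1 else if i = 3 then B 2 else B 3)"
  have e: "e 1 = T" "e 2 = B 1" "e 3 = B 2" "e 4 = B 3" by (simp_all add: e_def)
  have BT: "lorentz (B i) T = 0" for i using TB lorentz_commute by metis
  have "\<forall>i j. lorentz (e i) (e j) = (if i = j then if i = 1 then -1 else 1 else 0)"
    unfolding forall_4 e T TB B BT by simp
  then have "w = (\<Sum>i\<in>UNIV. ((if i = 1 then -1 else 1) * lorentz (e i) w) *\<^sub>R e i)"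
    by (intro lorentz_orthonormal_expansion) blast
  then show ?thesis
    by (simp add: sum_4 sum_3 e w lorentz_commute[of w])
qed

text \<open>The reflection in the hyperplane orthogonal to \<open>n = T + \<sigma> e\<^sub>0\<close> is an isometry that maps
  \<open>e\<^sub>0\<close>, up to sign, to \<open>T\<close>; the images of the three spatial unit vectors are the required basis.
  Choosing \<open>\<sigma>\<close> as the sign of the time component of \<open>T\<close> makes \<open>\<langle>n, n\<rangle> = -2 (1 + \<bar>T\<^sub>0\<bar>)\<close>
  nonzero for both time orientations.\<close>

lemma lorentz_orthonormal_complement_exists:
  assumes T: "lorentz T T = -1"
  obtains B :: "3 \<Rightarrow> real^4" where "\<And>i. lorentz T (B i) = 0"
    "\<And>i j. lorentz (B i) (B j) = (if i = j then 1 else 0)"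
proof -
  define \<sigma> :: real where "\<sigma> = (if T $ 1 \<ge> 0 then 1 else -1)"
  define n where "n = T + \<sigma> *\<^sub>R axis 1 1"
  define d where "d = 1 + \<bar>T $ 1\<bar>"
  \<comment> \<open>\<open>k\<close> numbers the spatial coordinates of \<open>real^4\<close>.\<close>
  define k where "k = (\<lambda>i::3. if i = 1 then 2 else if i = 2 then 3 else 4 :: 4)"
  define e :: "3 \<Rightarrow> real^4" where "e = (\<lambda>i. axis (k i) 1)"
  define B where "B = (\<lambda>i. e i + (T $ k i / d) *\<^sub>R n)"
  have "d > 0" by (simp add: d_def)
  have \<sigma>: "\<sigma> * \<sigma> = 1" "\<sigma> * T $ 1 = \<bar>T $ 1\<bar>" by (auto simp: \<sigma>_def)
  have k: "k 1 = 2" "k 2 = 3" "k 3 = 4" by (simp_all add: k_def)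
  have "\<forall>i j. lorentz (e i) (e j) = (if i = j then 1 else 0)"
    by (simp add: forall_3 e_def k lorentz_def axis_def)
  then have ee: "lorentz (e i) (e j) = (if i = j then 1 else 0)" for i j by blast
  have "\<forall>i. lorentz T (e i) = T $ k i"
    by (simp add: forall_3 e_def k lorentz_def axis_def)
  then have Te: "lorentz T (e i) = T $ k i" for i by blast
  have "\<forall>i. lorentz (axis 1 1) (e i) = 0"
    by (simp add: forall_3 e_def k lorentz_def axis_def)
  then have ne: "lorentz n (e i) = T $ k i" for i
    by (simp add: n_def lorentz.add_left lorentz.scaleR_left Te)
  have a: "lorentz T (axis 1 1) = - T $ 1" "lorentz (axis 1 1) T = - T $ 1"
      "lorentz (axis 1 1) (axis 1 1) = -1"
    by (simp_all add: lorentz_def axis_def)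
  have Tn: "lorentz T n = - d"
    using \<sigma> by (simp add: n_def d_def lorentz.add_right lorentz.scaleR_right T a)
  have nn: "lorentz n n = - 2 * d"
    using \<sigma> Tn by (simp add: n_def d_def lorentz.add_left lorentz.add_right lorentz.scaleR_left
        lorentz.scaleR_right T a algebra_simps)
  have "lorentz T (B i) = 0" for i
    using \<open>d > 0\<close> by (simp add: B_def lorentz.add_right lorentz.scaleR_right Te Tn)
  moreover have "lorentz (B i) (B j) = (if i = j then 1 else 0)" for i j
    using \<open>d > 0\<close> by (simp add: B_def lorentz.add_right lorentz.scaleR_right lorentz.add_left
        lorentz.scaleR_left ee ne nn lorentz_commute[of "e i" n] field_simps)
  ultimately show thesis by (rule that)
qed

section \<open>Smoothness of the unit tangent\<close>

lemma C1_differentiable_on_lorentz: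
  assumes "f C1_differentiable_on S" "g C1_differentiable_on S"
  shows "(\<lambda>t. lorentz (f t) (g t)) C1_differentiable_on S"
proof -
  obtain f' g' where f': "\<And>t. t \<in> S \<Longrightarrow> (f has_vector_derivative f' t) (at t)" "continuous_on S f'"
    and g': "\<And>t. t \<in> S \<Longrightarrow> (g has_vector_derivative g' t) (at t)" "continuous_on S g'"
    using assms by (auto simp: C1_differentiable_on_def)
  have "continuous_on S f" "continuous_on S g"
    using assms by (simp_all add: C1_differentiable_imp_continuous_on)
  then show ?thesis
    unfolding C1_differentiable_on_def using f' g'
    by (intro exI[of _ "\<lambda>t. lorentz (f t) (g' t) + lorentz (f' t) (g t)"] conjI ballI
        lorentz.has_vector_derivative continuous_intros lorentz.continuous_on) auto
qed

lemma C1_differentiable_on_inverse_sqrt: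
  fixes q :: "real \<Rightarrow> real"
  assumes "q C1_differentiable_on S" and pos: "\<And>t. t \<in> S \<Longrightarrow> q t > 0"
  shows "(\<lambda>t. inverse (sqrt (q t))) C1_differentiable_on S"
proof -
  obtain q' where q': "\<And>t. t \<in> S \<Longrightarrow> (q has_real_derivative q' t) (at t)" "continuous_on S q'"
    using assms(1) by (auto simp: C1_differentiable_on_def has_real_derivative_iff_has_vector_derivative)
  have "continuous_on S q"
    using assms(1) by (rule C1_differentiable_imp_continuous_on)
  have nz: "\<And>t. t \<in> S \<Longrightarrow> q t \<noteq> 0" using pos by force
  let ?D = "\<lambda>t. - (inverse (sqrt (q t)) * (inverse (sqrt (q t)) / 2 * q' t) * inverse (sqrt (q t)))"
  have "((\<lambda>t. inverse (sqrt (q t))) has_real_derivative ?D t) (at t)" if t: "t \<in> S" for t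
    using nz[OF t] by (intro DERIV_inverse' DERIV_chain2[OF DERIV_real_sqrt[OF pos[OF t]] q'(1)[OF t]]) simp
  moreover have "continuous_on S ?D"
    using nz q'(2) \<open>continuous_on S q\<close> by (intro continuous_intros) auto
  ultimately show ?thesis
    unfolding C1_differentiable_on_def has_real_derivative_iff_has_vector_derivative
    by (intro exI[of _ ?D] conjI ballI)
qed

section \<open>Normal fields with tangential derivative\<close>

lemma bishop_field_exists:
  assumes I: "open I" "is_interval I" "t0 \<in> I"
    and T: "continuous_on I T" "continuous_on I T'"
  obtains X where "X t0 = x0"
    "\<And>t. t \<in> I \<Longrightarrow> (X has_vector_derivative lorentz (T' t) (X t) *\<^sub>R T t) (at t)"
proof -
  define A where "A = (\<lambda>t. Blinfun (\<lambda>x. lorentz (T' t) x *\<^sub>R T t))"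
  have A: "blinfun_apply (A t) = (\<lambda>x. lorentz (T' t) x *\<^sub>R T t)" for t
    unfolding A_def
    by (intro bounded_linear_Blinfun_apply bounded_linear_scaleR_const lorentz.bounded_linear_right)
  have "continuous_on I A"
    by (rule continuous_on_blinfun_componentwise)
      (use T in \<open>auto simp: A intro!: continuous_intros lorentz.continuous_on\<close>)
  from linear_ode_solution_exists[OF I this, of x0] show thesis
    using that unfolding A by blast
qed

lemma has_vector_derivative_zero_imp_eq:
  assumes "open I" "is_interval I" "s \<in> I" "t \<in> I"
    and "\<And>t. t \<in> I \<Longrightarrow> (f has_vector_derivative 0) (at t)"
  shows "f s = f t"
proof -
  obtain c where "\<And>t. t \<in> I \<Longrightarrow> f t = c"
    using has_vector_derivative_zero_constant[of I f] assms(2,5)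
    by (metis has_vector_derivative_at_within is_interval_convex)
  with assms show ?thesis by simp
qed

text \<open>Here \<open>\<langle>T, X\<rangle>' = \<langle>T', X\<rangle> + \<langle>T', X\<rangle> \<langle>T, T\<rangle>\<close>, and the two terms cancel because \<open>T\<close> is a
  time-like unit vector.\<close>

lemma bishop_field_orthogonal:
  assumes I: "open I" "is_interval I" "t0 \<in> I" "t \<in> I"
    and T: "\<And>t. t \<in> I \<Longrightarrow> lorentz (T t) (T t) = -1"
    and T': "\<And>t. t \<in> I \<Longrightarrow> (T has_vector_derivative T' t) (at t)"
    and X': "\<And>t. t \<in> I \<Longrightarrow> (X has_vector_derivative lorentz (T' t) (X t) *\<^sub>R T t) (at t)"
    and start: "lorentz (T t0) (X t0) = 0"
  shows "lorentz (T t) (X t) = 0"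
proof -
  have "((\<lambda>t. lorentz (T t) (X t)) has_vector_derivative 0) (at t)" if "t \<in> I" for t
    using lorentz.has_vector_derivative[OF T'[OF that] X'[OF that]] T[OF that]
    by (simp add: lorentz.scaleR_right)
  from has_vector_derivative_zero_imp_eq[OF I this] start show ?thesis by simp
qed

lemma bishop_fields_lorentz_constant:
  assumes I: "open I" "is_interval I" "t0 \<in> I" "t \<in> I"
    and X: "\<And>t. t \<in> I \<Longrightarrow> lorentz (T t) (X t) = 0"
      "\<And>t. t \<in> I \<Longrightarrow> (X has_vector_derivative \<alpha> t *\<^sub>R T t) (at t)"
    and Y: "\<And>t. t \<in> I \<Longrightarrow> lorentz (T t) (Y t) = 0"
      "\<And>t. t \<in> I \<Longrightarrow> (Y has_vector_derivative \<beta> t *\<^sub>R T t) (at t)"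
  shows "lorentz (X t) (Y t) = lorentz (X t0) (Y t0)"
proof -
  have "((\<lambda>t. lorentz (X t) (Y t)) has_vector_derivative 0) (at t)" if "t \<in> I" for t
    using lorentz.has_vector_derivative[OF X(2)[OF that] Y(2)[OF that]] X(1)[OF that] Y(1)[OF that]
    by (simp add: lorentz.scaleR_right lorentz.scaleR_left lorentz_commute[of _ "T t"])
  from has_vector_derivative_zero_imp_eq[OF I this] show ?thesis by simp
qed

section \<open>Existence of Bishop frames\<close>

theorem lemma2p3:
  fixes \<gamma> :: "real \<Rightarrow> real^4" and I :: "real set"
  assumes "regular_timelike_curve \<gamma> I"
    and "C2_on \<gamma> I"
  shows "\<exists>T B. type_B_frame \<gamma> I T B"
proof (cases "I = {}")
  case True
  then show ?thesis by (auto simp: type_B_frame_def)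
next
  case False
  then obtain t0 where t0: "t0 \<in> I" by blast
  have I: "open I" "is_interval I"
    using assms(1) by (auto simp: regular_timelike_curve_def open_interval_def)
  obtain \<gamma>' where \<gamma>': "\<And>t. t \<in> I \<Longrightarrow> (\<gamma> has_vector_derivative \<gamma>' t) (at t)"
    and \<gamma>'_C1: "\<gamma>' C1_differentiable_on I"
    using assms(2) by (auto simp: C2_on_def)
  have vd: "vector_derivative \<gamma> (at t) = \<gamma>' t" if "t \<in> I" for t
    using \<gamma>'[OF that] by (rule vector_derivative_at)
  have timelike: "lorentz (\<gamma>' t) (\<gamma>' t) < 0" if "t \<in> I" for t
    using assms(1) that vd[OF that] by (auto simp: regular_timelike_curve_def)
  define v where "v = (\<lambda>t. sqrt (- lorentz (\<gamma>' t) (\<gamma>' t)))"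
  have v: "v t > 0" "v t * v t = - lorentz (\<gamma>' t) (\<gamma>' t)" "proper_speed \<gamma> t = v t" if "t \<in> I" for t
    using timelike[OF that] vd[OF that] by (simp_all add: v_def proper_speed_def)
  define T where "T = (\<lambda>t. inverse (v t) *\<^sub>R \<gamma>' t)"
  have T_C1: "T C1_differentiable_on I"
    unfolding T_def v_def using \<gamma>'_C1 timelike
    by (intro C1_differentiable_on_scaleR C1_differentiable_on_inverse_sqrt
        C1_differentiable_on_minus C1_differentiable_on_lorentz) auto
  then obtain T' where T': "\<And>t. t \<in> I \<Longrightarrow> (T has_vector_derivative T' t) (at t)"
    and T'_cont: "continuous_on I T'"
    by (auto simp: C1_differentiable_on_def)
  have T_cont: "continuous_on I T"
    using T_C1 by (rule C1_differentiable_imp_continuous_on)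
  have TT: "lorentz (T t) (T t) = -1" if "t \<in> I" for t
    using v(2)[OF that] timelike[OF that]
    by (simp add: T_def lorentz.scaleR_left lorentz.scaleR_right field_simps)
  have TT': "lorentz (T t) (T' t) = 0" if "t \<in> I" for t
  proof -
    have "((\<lambda>t. lorentz (T t) (T t)) has_vector_derivative 2 * lorentz (T t) (T' t)) (at t)"
      using lorentz.has_vector_derivative[OF T'[OF that] T'[OF that]]
      by (simp add: lorentz_commute[of "T' t"])
    moreover have "((\<lambda>t. lorentz (T t) (T t)) has_vector_derivative 0) (at t)"
      by (rule has_vector_derivative_transform_within_open[OF _ I(1) that, of "\<lambda>_. -1"]) (auto simp: TT)
    ultimately show ?thesis using vector_derivative_unique_at by force
  qed
  obtain e :: "3 \<Rightarrow> real^4" where e: "\<And>i. lorentz (T t0) (e i) = 0"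
      "\<And>i j. lorentz (e i) (e j) = (if i = j then 1 else 0)"
    using lorentz_orthonormal_complement_exists[OF TT[OF t0]] by blast
  have "\<forall>i. \<exists>X. X t0 = e i \<and>
      (\<forall>t\<in>I. (X has_vector_derivative lorentz (T' t) (X t) *\<^sub>R T t) (at t))"
    using bishop_field_exists[OF I t0 T_cont T'_cont] by metis
  then obtain B where B0: "\<And>i. B i t0 = e i"
    and B': "\<And>i t. t \<in> I \<Longrightarrow> (B i has_vector_derivative lorentz (T' t) (B i t) *\<^sub>R T t) (at t)"
    by metis
  have TB: "lorentz (T t) (B i t) = 0" if "t \<in> I" for i t
    using bishop_field_orthogonal[OF I t0 that TT T' B'] e(1) B0 by simp
  have BB: "lorentz (B i t) (B j t) = (if i = j then 1 else 0)" if "t \<in> I" for i j t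
    using bishop_fields_lorentz_constant[OF I t0 that TB B' TB B'] e(2) B0 by simp
  have B_C1: "B i C1_differentiable_on I" for i
  proof -
    have "continuous_on I (B i)"
      by (rule continuous_on_vector_derivative) (use B' in \<open>auto intro: has_vector_derivative_at_within\<close>)
    then have "continuous_on I (\<lambda>t. lorentz (T' t) (B i t) *\<^sub>R T t)"
      using T_cont T'_cont by (intro continuous_intros lorentz.continuous_on)
    then show ?thesis unfolding C1_differentiable_on_def using B'
      by (intro exI[of _ "\<lambda>t. lorentz (T' t) (B i t) *\<^sub>R T t"] conjI ballI)
  qed
  define b where "b = (\<lambda>i t. lorentz (T' t) (B i t) / v t)"
  have "type_B_frame \<gamma> I T B"
    unfolding type_B_frame_def
  proof (intro conjI ballI allI exI[of _ b] T_C1 B_C1 TB BB)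
    fix t assume t: "t \<in> I"
    show "has_proper_time_derivative \<gamma> \<gamma> (T t) t"
      using \<gamma>'[OF t] v[OF t] by (simp add: has_proper_time_derivative_def T_def)
    have "T' t = (\<Sum>i\<in>UNIV. lorentz (T' t) (B i t) *\<^sub>R B i t)"
      using t by (intro lorentz_orthonormal_complement_expansion[of "T t"] TT TB BB TT')
    also have "\<dots> = v t *\<^sub>R (\<Sum>i\<in>UNIV. b i t *\<^sub>R B i t)"
      using v(1)[OF t] by (simp add: b_def scaleR_sum_right)
    finally show "has_proper_time_derivative \<gamma> T (\<Sum>i\<in>UNIV. b i t *\<^sub>R B i t) t"
      using T'[OF t] v(3)[OF t] by (simp add: has_proper_time_derivative_def)
    show "has_proper_time_derivative \<gamma> (B i) (b i t *\<^sub>R T t) t" for i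
      using B'[OF t, of i] v[OF t] by (simp add: has_proper_time_derivative_def b_def)
  qed
  then show ?thesis by blast
qed

end
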